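(* Let $f(x)=\tfrac12 x^\top Qx-p^\top x+r$ on $\mathbb{R}^d$, where $Q$ is symmetric positive definite with eigenvalues $0<\mu=\lambda_1\le\lambda_2\le\dots\le\lambda_d=L$. Consider the noisy gradient descent iterations $x_{k+1}=x_k-\alpha(\nabla f(x_k)+w_k)$ with constant stepsize $\alpha\in(0,2/L)$, where the noise $\{w_k\}$ satisfies the noise assumption of the context. Then the robustness $\mathcal{J}(\alpha)$ of gradient descent is $$\mathcal{J}(\alpha)=\sum_{i=1}^d\frac{\alpha^2\lambda_i}{2\left(1-(1-\alpha\lambda_i)^2\right)}=\alpha\sum_{i=1}^d\frac{1}{2(2-\alpha\lambda_i)}.$$
   Context: Noise assumption: for some $\sigma>0$ and every $k\ge0$, the random vector $w_k\in\mathbb{R}^d$ has zero mean, is independent of $\{x_i\}_{i=1}^k$, and $\mathbb{E}[w_kw_k^\top]=\sigma^2I_d$; the initial point $x_0$ is deterministic. The robustness of the algorithm is $\mathcal{J}=\limsup_{k\to\infty}\frac1{\sigma^2}\mathbb{E}[f(x_k)-f^*]$ with $f^*=\min f$ (for quadratic $f$ with a stable iteration the limsup is a limit). *)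

theory Defs
  imports "HOL-Probability.Probability"
begin

definition pos_def_matrix :: "real^'n^'n \<Rightarrow> bool" where
  "pos_def_matrix Q \<longleftrightarrow> transpose Q = Q \<and> (\<forall>v. v \<noteq> 0 \<longrightarrow> v \<bullet> (Q *v v) > 0)"

text \<open>
  The numbers \<open>lam 1 \<le> \<dots> \<le> lam d\<close>, with \<open>d = CARD('n)\<close>, are the eigenvalues of \<open>Q\<close> counted
  with algebraic multiplicity: the characteristic polynomial of \<open>Q\<close> splits with exactly these roots.
  Values of \<open>lam\<close> outside \<open>{1..d}\<close> are irrelevant.
\<close>
definition sorted_eigenvalues :: "real^'n^'n \<Rightarrow> (nat \<Rightarrow> real) \<Rightarrow> bool" where
  "sorted_eigenvalues Q lam \<longleftrightarrow>
     (\<forall>t. det (mat t - Q) = (\<Prod>i = 1..CARD('n). t - lam i)) \<and>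
     mono_on {1..CARD('n)} lam"

definition gradient :: "('a::real_inner \<Rightarrow> real) \<Rightarrow> 'a \<Rightarrow> 'a" where
  "gradient f x = (THE D. GDERIV f x :> D)"

primrec noisy_gd ::
  "('a::real_inner \<Rightarrow> real) \<Rightarrow> real \<Rightarrow> 'a \<Rightarrow> (nat \<Rightarrow> 's \<Rightarrow> 'a) \<Rightarrow> nat \<Rightarrow> 's \<Rightarrow> 'a" where
  "noisy_gd f \<alpha> x0 w 0 = (\<lambda>\<omega>. x0)"
| "noisy_gd f \<alpha> x0 w (Suc k) =
     (\<lambda>\<omega>. noisy_gd f \<alpha> x0 w k \<omega> - \<alpha> *\<^sub>R (gradient f (noisy_gd f \<alpha> x0 w k \<omega>) + w k \<omega>))"

text \<open>
  Independence of two random variables, as independence of the generated sigma-algebras. Unlike the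
  library's \<open>indep_var\<close>, the two variables may take values in different types.
\<close>
definition indep_rv ::
  "'s measure \<Rightarrow> 'b measure \<Rightarrow> ('s \<Rightarrow> 'b) \<Rightarrow> 'c measure \<Rightarrow> ('s \<Rightarrow> 'c) \<Rightarrow> bool" where
  "indep_rv M S X T Y \<longleftrightarrow>
     prob_space.indep_set M (sets (vimage_algebra (space M) X S)) (sets (vimage_algebra (space M) Y T))"

text \<open>
  \<open>w k\<close> is independent of the whole tuple \<open>(x 1, \<dots>, x k)\<close>, not merely of each entry. The
  integrability requirements say that the mean and the matrix \<open>E[w w\<^sup>T]\<close> exist.
\<close>
definition noise_assumption ::
  "'s measure \<Rightarrow> real \<Rightarrow> (nat \<Rightarrow> 's \<Rightarrow> real^'n) \<Rightarrow> (nat \<Rightarrow> 's \<Rightarrow> real^'n) \<Rightarrow> bool" where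
  "noise_assumption M \<sigma> w x \<longleftrightarrow> \<sigma> > 0 \<and>
     (\<forall>k. w k \<in> borel_measurable M \<and>
          integrable M (w k) \<and> (\<integral>\<omega>. w k \<omega> \<partial>M) = 0 \<and>
          indep_rv M borel (w k) (PiM {1..k} (\<lambda>_. borel)) (\<lambda>\<omega>. \<lambda>i\<in>{1..k}. x i \<omega>) \<and>
          integrable M (\<lambda>\<omega>. (\<chi> i j. w k \<omega> $ i * w k \<omega> $ j) :: real^'n^'n) \<and>
          (\<integral>\<omega>. (\<chi> i j. w k \<omega> $ i * w k \<omega> $ j) \<partial>M) = \<sigma>\<^sup>2 *\<^sub>R (mat 1 :: real^'n^'n))"

text \<open>
  \<open>INF y. f y\<close> stands for the minimum of \<open>f\<close>; use only for \<open>f\<close> that attains its minimum and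
  \<open>f (x k \<omega>)\<close> integrable in \<open>\<omega>\<close>. The limsup is extended-real, so an unbounded sequence gives \<open>\<infinity>\<close>.
\<close>
definition robustness ::
  "'s measure \<Rightarrow> real \<Rightarrow> ('a \<Rightarrow> real) \<Rightarrow> (nat \<Rightarrow> 's \<Rightarrow> 'a) \<Rightarrow> ereal" where
  "robustness M \<sigma> f x =
     limsup (\<lambda>k. ereal (1 / \<sigma>\<^sup>2 * (\<integral>\<omega>. f (x k \<omega>) - (INF y. f y) \<partial>M)))"

end

theory Submission
  imports Defs
begin

text \<open>
  In an orthonormal eigenbasis \<open>v\<^sub>i\<close> of \<open>Q\<close> the error \<open>x\<^sub>k - x\<^sup>*\<close> decouples: its coordinates
  satisfy \<open>z\<^bsub>i,k+1\<^esub> = (1 - \<alpha> \<lambda>\<^sub>i) z\<^bsub>i,k\<^esub> - \<alpha> (v\<^sub>i \<bullet> w\<^sub>k)\<close>. Independence kills the cross term, so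
  \<open>E[z\<^bsub>i,k+1\<^esub>\<^sup>2] = (1 - \<alpha> \<lambda>\<^sub>i)\<^sup>2 E[z\<^bsub>i,k\<^esub>\<^sup>2] + \<alpha>\<^sup>2 \<sigma>\<^sup>2\<close>, which converges to
  \<open>\<alpha>\<^sup>2 \<sigma>\<^sup>2 / (1 - (1 - \<alpha> \<lambda>\<^sub>i)\<^sup>2)\<close>, and \<open>f(x\<^sub>k) - f\<^sup>* = 1/2 \<Sum>\<^sub>i \<lambda>\<^sub>i z\<^bsub>i,k\<^esub>\<^sup>2\<close>. Comparing characteristic
  polynomials identifies the eigenvalues of the basis with the given \<open>\<lambda>\<^sub>i\<close>, with multiplicity.
\<close>

section \<open>Spectral theorem for symmetric real matrices\<close>

text \<open>Working on an invariant subspace allows use on the orthogonal complement of eigenvectors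
  already found.\<close>

lemma self_adjoint_eigenvector:
  fixes f :: "'a::euclidean_space \<Rightarrow> 'a"
  assumes f: "linear f" and adj: "\<And>x y. f x \<bullet> y = x \<bullet> f y"
    and S: "subspace S" and inv: "\<And>x. x \<in> S \<Longrightarrow> f x \<in> S" and nt: "S \<noteq> {0}"
  obtains v c where "v \<in> S" "norm v = 1" "f v = c *\<^sub>R v"
proof -
  let ?K = "S \<inter> sphere 0 1"
  have scaled: "x /\<^sub>R norm x \<in> ?K" if "x \<in> S" "x \<noteq> 0" for x
    using that S by (simp add: subspace_scale)
  obtain x where "x \<in> S" "x \<noteq> 0"
    using nt subspace_0[OF S] by blast
  then have "?K \<noteq> {}"
    using scaled by blast
  moreover have "compact ?K"
    using S by (intro closed_Int_compact closed_subspace) auto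
  moreover have "continuous_on ?K (\<lambda>x. x \<bullet> f x)"
    using f by (intro continuous_intros linear_continuous_on) (simp add: linear_conv_bounded_linear)
  ultimately obtain v where v: "v \<in> ?K" and max: "\<And>y. y \<in> ?K \<Longrightarrow> y \<bullet> f y \<le> v \<bullet> f v"
    by (metis continuous_attains_sup)
  \<comment> \<open>At a maximiser \<open>v\<close> of the Rayleigh quotient, \<open>c - f\<close> is positive semidefinite on \<open>S\<close> with
    \<open>v \<bullet> (c - f) v = 0\<close>; moving from \<open>v\<close> in the direction \<open>- (c - f) v\<close> shows \<open>(c - f) v = 0\<close>.\<close>
  define c where "c = v \<bullet> f v"
  define g where "g x = c *\<^sub>R x - f x" for x
  have g: "linear g"
    unfolding g_def using f by (intro linear_compose_sub linear_compose_scale_right linear_ident)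
  have g_adj: "g x \<bullet> y = x \<bullet> g y" for x y
    by (simp add: g_def inner_diff adj)
  have g_nonneg: "0 \<le> y \<bullet> g y" if "y \<in> S" for y
  proof (cases "y = 0")
    case False
    have "(y /\<^sub>R norm y) \<bullet> f (y /\<^sub>R norm y) \<le> c"
      using max[OF scaled[OF that False]] by (simp add: c_def)
    then have "y \<bullet> f y \<le> c * (norm y)\<^sup>2"
      using False by (simp add: linear_scale[OF f] field_simps power2_eq_square)
    then show ?thesis
      by (simp add: g_def inner_diff power2_norm_eq_inner)
  qed simp
  have vv: "v \<bullet> v = 1"
    using v by (simp add: norm_eq_1)
  have v_gv: "v \<bullet> g v = 0"
    using vv by (simp add: g_def inner_diff c_def)
  define u where "u = g v"
  define a where "a = u \<bullet> u"
  define b where "b = u \<bullet> g u"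
  have "u \<in> S"
    unfolding u_def g_def using v inv S by (auto intro!: subspace_diff subspace_scale)
  have "b \<ge> 0"
    using g_nonneg[OF \<open>u \<in> S\<close>] by (simp add: b_def)
  have "u = 0"
  proof (rule ccontr)
    assume "u \<noteq> 0"
    then have "a > 0" by (simp add: a_def)
    \<comment> \<open>The quadratic form of \<open>g\<close> at \<open>v - t *\<^sub>R u\<close> is
      \<open>t * (t * b - 2 * a)\<close>. This \<open>t\<close> is small enough that
      \<open>t * b \<le> a\<close>, which makes the form negative; the \<open>+ 1\<close> guards
      against \<open>b = 0\<close>.\<close>
    define t where "t = a / (b + 1)"
    have "t > 0" using \<open>a > 0\<close> \<open>b \<ge> 0\<close> by (simp add: t_def)
    have vu: "v \<bullet> g u = a"
      by (simp add: a_def u_def g_adj flip: g_adj)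
    have "0 \<le> (v - t *\<^sub>R u) \<bullet> g (v - t *\<^sub>R u)"
      using v \<open>u \<in> S\<close> S by (intro g_nonneg subspace_diff subspace_scale) auto
    also have "\<dots> = t * (t * b - 2 * a)"
      using v_gv vu
      by (simp add: linear_diff[OF g] linear_scale[OF g] inner_diff algebra_simps
            flip: u_def a_def b_def)
    finally have "2 * a \<le> t * b"
      using \<open>t > 0\<close> by (simp add: zero_le_mult_iff)
    moreover have "t * b \<le> a"
      using \<open>a > 0\<close> \<open>b \<ge> 0\<close> by (simp add: t_def field_simps)
    ultimately show False using \<open>a > 0\<close> by simp
  qed
  then have "f v = c *\<^sub>R v"
    by (simp add: u_def g_def)
  then show ?thesis
    using that[of v c] v by simp
qed

text \<open>Orthonormal sets are independent, so there is an orthonormal set of eigenvectors of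
  largest size. Self-adjointness makes its orthogonal complement invariant; if that were nonzero, it
  would contain a further unit eigenvector.\<close>

lemma self_adjoint_eigenbasis:
  fixes f :: "'a::euclidean_space \<Rightarrow> 'a"
  assumes f: "linear f" and adj: "\<And>x y. f x \<bullet> y = x \<bullet> f y"
  obtains B where "pairwise orthogonal B" "\<And>b. b \<in> B \<Longrightarrow> norm b = 1"
    "\<And>b. b \<in> B \<Longrightarrow> \<exists>c. f b = c *\<^sub>R b" "finite B" "card B = DIM('a)"
proof -
  define P where "P B \<longleftrightarrow> pairwise orthogonal B \<and> (\<forall>b\<in>B. norm b = 1 \<and> (\<exists>c. f b = c *\<^sub>R b))" for B
  have indep: "independent B" if "P B" for B
    using that by (intro pairwise_orthogonal_independent) (auto simp: P_def)
  have "P {}" by (simp add: P_def)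
  moreover have "\<forall>B. P B \<longrightarrow> card B < Suc DIM('a)"
    using indep independent_bound by (auto simp: less_Suc_eq_le)
  ultimately obtain B where B: "P B" and max: "\<And>C. P C \<Longrightarrow> card C \<le> card B"
    using ex_has_greatest_nat[of P "{}" card] by blast
  have fin: "finite B"
    using indep[OF B] independent_bound by blast
  define S where "S = {x. \<forall>b\<in>B. orthogonal b x}"
  have "subspace S"
    by (auto simp: S_def subspace_def orthogonal_def inner_simps)
  moreover have "f x \<in> S" if "x \<in> S" for x
    using that B by (fastforce simp: S_def P_def orthogonal_def simp flip: adj)
  moreover have "False" if v: "v \<in> S" "norm v = 1" "f v = c *\<^sub>R v" for v c
  proof -
    have "P (insert v B)"
      using v B by (auto simp: P_def S_def pairwise_insert orthogonal_commute)
    moreover have "v \<notin> B"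
      using v by (auto simp: S_def orthogonal_def norm_eq_1)
    ultimately show False
      using max[of "insert v B"] fin by simp
  qed
  ultimately have "S = {0}"
    using self_adjoint_eigenvector[OF f adj] by metis
  have "span B = UNIV"
  proof (rule ccontr)
    assume "span B \<noteq> UNIV"
    then obtain x where "x \<noteq> 0" "\<And>y. y \<in> span B \<Longrightarrow> orthogonal x y"
      using orthogonal_to_subspace_exists_gen[of B UNIV] by auto
    then have "x \<in> S"
      by (auto simp: S_def orthogonal_commute span_base)
    with \<open>S = {0}\<close> \<open>x \<noteq> 0\<close> show False by simp
  qed
  then have "card B = DIM('a)"
    using indep[OF B] by (metis dim_span_eq_card_independent dim_UNIV)
  with B fin that show ?thesis
    by (auto simp: P_def)
qed

text \<open>Indexing the basis by \<open>'n\<close> itself lets the eigenvectors serve as the rows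
  of a square matrix below.\<close>

lemma symmetric_matrix_eigenbasis:
  fixes Q :: "real^'n^'n"
  assumes "transpose Q = Q"
  obtains v :: "'n \<Rightarrow> real^'n" and e where
    "\<And>i j. v i \<bullet> v j = (if i = j then 1 else 0)" "\<And>i. Q *v v i = e i *\<^sub>R v i"
proof -
  have "(Q *v x) \<bullet> y = x \<bullet> (Q *v y)" for x y
    using assms by (simp add: dot_lmul_matrix flip: vector_transpose_matrix)
  then obtain B where B: "pairwise orthogonal B" "\<And>b. b \<in> B \<Longrightarrow> norm b = 1"
    "\<And>b. b \<in> B \<Longrightarrow> \<exists>c. Q *v b = c *\<^sub>R b" "finite B" "card B = CARD('n)"
    using self_adjoint_eigenbasis[OF matrix_vector_mul_linear[of Q]] by auto
  then obtain v where v: "bij_betw v (UNIV :: 'n set) B"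
    using finite_same_card_bij[of "UNIV :: 'n set" B] by auto
  then have vB: "v i \<in> B" for i
    by (auto dest: bij_betwE)
  have "v i \<bullet> v j = (if i = j then 1 else 0)" for i j
    using B(1) B(2)[OF vB[of i]] vB[of i] vB[of j] bij_betw_imp_inj_on[OF v]
    by (auto simp: pairwise_def orthogonal_def norm_eq_1 inj_eq)
  moreover obtain e where "\<And>i. Q *v v i = e i *\<^sub>R v i"
    using B(3)[OF vB] by metis
  ultimately show ?thesis
    using that by blast
qed

text \<open>Orthonormality says that the matrix \<open>P\<close> with rows \<open>v i\<close> has
  right inverse \<open>transpose P\<close>. For square matrices this is also a left inverse, and the
  expansion is \<open>transpose P *v (P *v x) = x\<close>.\<close>

lemma orthonormal_expansion:
  fixes v :: "'n::finite \<Rightarrow> real^'n"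
  assumes orth: "\<And>i j. v i \<bullet> v j = (if i = j then 1 else 0)"
  shows "(\<Sum>i\<in>UNIV. (v i \<bullet> x) *\<^sub>R v i) = x"
proof -
  define P :: "real^'n^'n" where "P = (\<chi> i. v i)"
  have "P ** transpose P = mat 1"
    using orth by (simp add: P_def matrix_matrix_mult_def transpose_def mat_def vec_eq_iff inner_vec_def)
  then have "transpose P ** P = mat 1"
    using matrix_left_right_inverse by blast
  then have "transpose P *v (P *v x) = x"
    by (simp add: matrix_vector_mul_assoc)
  moreover have "transpose P *v (P *v x) = (\<Sum>i\<in>UNIV. (v i \<bullet> x) *\<^sub>R v i)"
    by (simp add: P_def matrix_vector_mult_def transpose_def vec_eq_iff inner_vec_def mult.commute)
  ultimately show ?thesis by simp
qed

section \<open>Characteristic polynomials and eigenvalue multiplicities\<close>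

text \<open>The columns of \<open>transpose P\<close> are eigenvectors, so it intertwines
  \<open>mat t - Q\<close> with the diagonal matrix \<open>D\<close>. Its determinant is nonzero and
  cancels.\<close>

lemma char_poly_of_eigenbasis:
  fixes Q :: "real^'n^'n" and v :: "'n \<Rightarrow> real^'n"
  assumes orth: "\<And>i j. v i \<bullet> v j = (if i = j then 1 else 0)"
    and eig: "\<And>i. Q *v v i = e i *\<^sub>R v i"
  shows "det (mat t - Q) = (\<Prod>i\<in>UNIV. t - e i)"
proof -
  define P :: "real^'n^'n" where "P = (\<chi> i. v i)"
  define D :: "real^'n^'n" where "D = (\<chi> i j. if i = j then t - e i else 0)"
  have PP: "P ** transpose P = mat 1"
    using orth by (simp add: P_def matrix_matrix_mult_def transpose_def mat_def vec_eq_iff inner_vec_def)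
  have Qv: "(mat t - Q) *v v j = (t - e j) *\<^sub>R v j" for j
  proof -
    have "(mat t :: real^'n^'n) *v v j = t *\<^sub>R v j"
      by (simp add: vec_eq_iff matrix_vector_mult_def mat_def if_distrib[of "\<lambda>a. a * _"] cong: if_cong)
    then show ?thesis
      by (simp add: matrix_vector_mult_diff_rdistrib eig scaleR_left_diff_distrib)
  qed
  have "(mat t - Q) ** transpose P = transpose P ** D"
  proof -
    have "column j ((mat t - Q) ** transpose P) = (t - e j) *\<^sub>R v j" for j
    proof -
      have "column j (transpose P) = v j"
        by (simp add: P_def column_def transpose_def)
      then show ?thesis
        using Qv[of j] by (simp add: vec_eq_iff column_def matrix_matrix_mult_def matrix_vector_mult_def)
    qed
    then have "((mat t - Q) ** transpose P) $ i $ j = (t - e j) * v j $ i" for i j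
      by (simp add: vec_eq_iff column_def)
    then show ?thesis
      by (simp add: vec_eq_iff D_def P_def matrix_matrix_mult_def transpose_def
          if_distrib[of "\<lambda>a. _ * a"] mult.commute cong: if_cong)
  qed
  then have "det (mat t - Q) * det (transpose P) = det (transpose P) * det D"
    by (metis det_mul)
  moreover have "det P * det (transpose P) = 1"
    by (metis PP det_mul det_I)
  ultimately have "det (mat t - Q) = det D"
    by (metis mult.commute mult_cancel_right mult_zero_right zero_neq_one)
  also have "\<dots> = (\<Prod>i\<in>UNIV. t - e i)"
    by (subst det_diagonal) (auto simp: D_def)
  finally show ?thesis .
qed

text \<open>In characteristic 0 the field is infinite, so polynomials that agree as functions are
  equal and have the same roots. Multisets keep the multiplicities and avoid choosing a bijection
  between \<open>A\<close> and \<open>B\<close>.\<close>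

lemma prod_linear_factors_unique:
  fixes a :: "'i \<Rightarrow> 'a::field_char_0" and b :: "'j \<Rightarrow> 'a"
  assumes "\<And>t. (\<Prod>i\<in>A. t - a i) = (\<Prod>j\<in>B. t - b j)"
  shows "(\<Sum>i\<in>A. {#a i#}) = (\<Sum>j\<in>B. {#b j#})"
proof -
  have "(\<Prod>i\<in>A. [:- a i, 1:]) = (\<Prod>j\<in>B. [:- b j, 1:])"
    using assms by (intro poly_eq_poly_eq_iff[THEN iffD1] ext) (simp add: poly_prod)
  then show ?thesis
    using proots_prod[of A "\<lambda>i. [:- a i, 1:]"] proots_prod[of B "\<lambda>j. [:- b j, 1:]"] by simp
qed

lemma sum_mset_image_sum_single:
  "finite A \<Longrightarrow> (\<Sum>x\<in>#(\<Sum>i\<in>A. {#a i#}). h x) = (\<Sum>i\<in>A. h (a i))"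
  by (induction A rule: finite_induct) auto

lemma set_mset_sum_single:
  "finite A \<Longrightarrow> set_mset (\<Sum>i\<in>A. {#a i#}) = a ` A"
  by (induction A rule: finite_induct) auto

section \<open>Differentiation of the quadratic objective\<close>

text \<open>By symmetry the two terms of the product rule coincide, which absorbs the factor 1/2. As
  \<open>gradient\<close> is a definite description, uniqueness of the derivative is needed
  too.\<close>

lemma gradient_quadratic:
  fixes Q :: "real^'n^'n"
  assumes "transpose Q = Q"
  shows "gradient (\<lambda>x. 1/2 * (x \<bullet> (Q *v x)) - p \<bullet> x + r) x = Q *v x - p"
proof -
  let ?f = "\<lambda>x. 1/2 * (x \<bullet> (Q *v x)) - p \<bullet> x + r"
  have sym: "x \<bullet> (Q *v h) = h \<bullet> (Q *v x)" for h
    using assms by (metis dot_lmul_matrix inner_commute vector_transpose_matrix)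
  have Qd: "((\<lambda>x. Q *v x) has_derivative (\<lambda>h. Q *v h)) (at x)"
    by (intro bounded_linear_imp_has_derivative matrix_vector_mul_bounded_linear)
  have G: "GDERIV ?f x :> Q *v x - p"
    unfolding gderiv_def
    by (rule Qd derivative_eq_intros refl)+
      (simp add: fun_eq_iff sym inner_diff_right inner_commute[of p] inner_commute[of "Q *v x"])
  have "D = Q *v x - p" if "GDERIV ?f x :> D" for D
    using has_derivative_unique[OF that[unfolded gderiv_def] G[unfolded gderiv_def]]
    by (metis vector_eq_rdot inner_commute)
  with G show ?thesis
    unfolding gradient_def by (rule the_equality)
qed

section \<open>Independence and second moments of the noise-driven recursion\<close>

text \<open>A measurable function of a variable generates a smaller sigma-algebra. Mapping both
  variables into a common type gives access to the product rule for expectations under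
  \<open>indep_var\<close>.\<close>

lemma (in prob_space) indep_rv_compose:
  assumes indep: "indep_rv M S X T Y"
    and X: "X \<in> measurable M S" and Y: "Y \<in> measurable M T"
    and g: "g \<in> measurable S S'" and h: "h \<in> measurable T T'"
  shows "indep_var S' (\<lambda>\<omega>. g (X \<omega>)) T' (\<lambda>\<omega>. h (Y \<omega>))"
proof -
  have sub: "sets (vimage_algebra (space M) (\<lambda>\<omega>. k (Z \<omega>)) N') \<subseteq> sets (vimage_algebra (space M) Z N)"
    if "Z \<in> measurable M N" "k \<in> measurable N N'" for Z N k N'
  proof (rule sets_image_in_sets)
    have "Z \<in> space M \<rightarrow> space N"
      using that(1) by (auto dest: measurable_space)
    then show "(\<lambda>\<omega>. k (Z \<omega>)) \<in> measurable (vimage_algebra (space M) Z N) N'"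
      by (intro measurable_compose[OF measurable_vimage_algebra1 that(2)])
  qed simp
  have "indep_set (sets (vimage_algebra (space M) (\<lambda>\<omega>. g (X \<omega>)) S'))
      (sets (vimage_algebra (space M) (\<lambda>\<omega>. h (Y \<omega>)) T'))"
    using indep sub[OF X g] sub[OF Y h] unfolding indep_rv_def indep_set_def
    by (auto elim!: indep_sets_mono_sets split: bool.splits)
  then show ?thesis
    using X Y g h by (auto simp: indep_var_eq sets_vimage_algebra)
qed

text \<open>The deviation from the fixed point \<open>c / (1 - b)\<close> is multiplied by
  \<open>b\<close> at every step.\<close>

lemma affine_recurrence_tendsto:
  fixes a :: "nat \<Rightarrow> real"
  assumes "\<bar>b\<bar> < 1" and "\<And>k. a (Suc k) = b * a k + c"
  shows "a \<longlonglongrightarrow> c / (1 - b)"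
proof -
  define l where "l = c / (1 - b)"
  have fp: "b * l + c = l"
    using assms(1) by (auto simp: l_def field_simps)
  have "a k = b ^ k * (a 0 - l) + l" for k
  proof (induction k)
    case (Suc k)
    have "a (Suc k) = b ^ Suc k * (a 0 - l) + (b * l + c)"
      by (simp add: assms(2) Suc algebra_simps)
    then show ?case
      by (simp only: fp)
  qed simp
  then have "a = (\<lambda>k. b ^ k * (a 0 - l) + l)"
    by blast
  moreover have "(\<lambda>k. b ^ k * (a 0 - l) + l) \<longlonglongrightarrow> 0 * (a 0 - l) + l"
    using assms(1) by (intro tendsto_intros LIMSEQ_power_zero) auto
  ultimately show ?thesis
    by (simp add: l_def)
qed

lemma (in prob_space) ar1_second_moment:
  fixes z n :: "nat \<Rightarrow> 'a \<Rightarrow> real"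
  assumes z0: "\<And>\<omega>. z 0 \<omega> = c" and zS: "\<And>k \<omega>. z (Suc k) \<omega> = q * z k \<omega> - \<alpha> * n k \<omega>"
    and q: "\<bar>q\<bar> < 1"
    and n: "\<And>k. integrable M (n k)" "\<And>k. expectation (n k) = 0"
    and n2: "\<And>k. integrable M (\<lambda>\<omega>. (n k \<omega>)\<^sup>2)" "\<And>k. expectation (\<lambda>\<omega>. (n k \<omega>)\<^sup>2) = s"
    and indep: "\<And>k. indep_var borel (n k) borel (z k)"
  shows "integrable M (\<lambda>\<omega>. (z k \<omega>)\<^sup>2)"
    and "(\<lambda>k. expectation (\<lambda>\<omega>. (z k \<omega>)\<^sup>2)) \<longlonglongrightarrow> \<alpha>\<^sup>2 * s / (1 - q\<^sup>2)"
proof -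
  have z: "integrable M (z k)" for k
    by (induction k) (simp_all add: z0 zS n)
  \<comment> \<open>A product of independent integrable variables is integrable, so the cross term
    is handled before square integrability of \<open>z k\<close> is known.\<close>
  have nz: "integrable M (\<lambda>\<omega>. n k \<omega> * z k \<omega>)" "expectation (\<lambda>\<omega>. n k \<omega> * z k \<omega>) = 0" for k
    using indep_var_integrable[OF indep n(1) z, of k] indep_var_lebesgue_integral[OF indep n(1) z, of k]
    by (simp_all add: n(2))
  have sq: "(z (Suc k) \<omega>)\<^sup>2 = q\<^sup>2 * (z k \<omega>)\<^sup>2 - 2 * \<alpha> * q * (n k \<omega> * z k \<omega>) + \<alpha>\<^sup>2 * (n k \<omega>)\<^sup>2" for k \<omega>
    by (simp add: zS power2_eq_square algebra_simps)
  show z2: "integrable M (\<lambda>\<omega>. (z k \<omega>)\<^sup>2)" for k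
    by (induction k) (simp_all add: z0 sq nz n2)
  show "(\<lambda>k. expectation (\<lambda>\<omega>. (z k \<omega>)\<^sup>2)) \<longlonglongrightarrow> \<alpha>\<^sup>2 * s / (1 - q\<^sup>2)"
  proof (rule affine_recurrence_tendsto)
    show "\<bar>q\<^sup>2\<bar> < 1"
      using q by (simp add: abs_square_less_1)
    show "expectation (\<lambda>\<omega>. (z (Suc k) \<omega>)\<^sup>2) = q\<^sup>2 * expectation (\<lambda>\<omega>. (z k \<omega>)\<^sup>2) + \<alpha>\<^sup>2 * s" for k
      by (simp add: sq nz n2 z2)
  qed
qed

text \<open>The square of \<open>u \<bullet> w k \<omega>\<close> is a bounded linear functional of
  the outer product of \<open>w k \<omega>\<close> with itself, so the expectation can be taken
  inside the functional.\<close>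

lemma noise_component:
  fixes w x :: "nat \<Rightarrow> 's \<Rightarrow> real^'n"
  assumes "noise_assumption M \<sigma> w x"
  shows "integrable M (\<lambda>\<omega>. u \<bullet> w k \<omega>)" "(\<integral>\<omega>. u \<bullet> w k \<omega> \<partial>M) = 0"
    "integrable M (\<lambda>\<omega>. (u \<bullet> w k \<omega>)\<^sup>2)" "(\<integral>\<omega>. (u \<bullet> w k \<omega>)\<^sup>2 \<partial>M) = \<sigma>\<^sup>2 * (u \<bullet> u)"
proof -
  define W :: "'s \<Rightarrow> real^'n^'n" where "W \<omega> = (\<chi> i j. w k \<omega> $ i * w k \<omega> $ j)" for \<omega>
  have w: "integrable M (w k)" "(\<integral>\<omega>. w k \<omega> \<partial>M) = 0"
    and W: "integrable M W" "(\<integral>\<omega>. W \<omega> \<partial>M) = \<sigma>\<^sup>2 *\<^sub>R mat 1"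
    using assms by (simp_all add: noise_assumption_def W_def[abs_def])
  show "integrable M (\<lambda>\<omega>. u \<bullet> w k \<omega>)" "(\<integral>\<omega>. u \<bullet> w k \<omega> \<partial>M) = 0"
    using w by simp_all
  have "linear (\<lambda>A :: real^'n^'n. u \<bullet> (A *v u))"
    by (rule linearI) (simp_all add: matrix_vector_mult_add_rdistrib inner_add_right
        flip: scaleR_matrix_vector_assoc)
  then have bl: "bounded_linear (\<lambda>A :: real^'n^'n. u \<bullet> (A *v u))"
    by (simp add: linear_conv_bounded_linear)
  have sq: "(u \<bullet> w k \<omega>)\<^sup>2 = u \<bullet> (W \<omega> *v u)" for \<omega>
    by (simp add: W_def inner_vec_def matrix_vector_mult_def power2_eq_square sum_product
        sum_distrib_left mult_ac)
  show "integrable M (\<lambda>\<omega>. (u \<bullet> w k \<omega>)\<^sup>2)"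
    unfolding sq by (rule integrable_bounded_linear[OF bl W(1)])
  show "(\<integral>\<omega>. (u \<bullet> w k \<omega>)\<^sup>2 \<partial>M) = \<sigma>\<^sup>2 * (u \<bullet> u)"
    unfolding sq using integral_bounded_linear[OF bl W(1)] W(2)
    by (simp flip: scaleR_matrix_vector_assoc)
qed

text \<open>Projecting the tuple of past iterates to its last entry turns the joint independence in
  the noise assumption into independence of \<open>w k\<close> and \<open>x k\<close>.\<close>

lemma (in prob_space) noise_indep_functional:
  fixes w x :: "nat \<Rightarrow> 'a \<Rightarrow> real^'n"
  assumes noise: "noise_assumption M \<sigma> w x"
    and x: "\<And>k. x k \<in> borel_measurable M" and x0: "\<And>\<omega>. x 0 \<omega> = x0"
    and g: "g \<in> borel_measurable borel" and h: "h \<in> borel_measurable borel"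
  shows "indep_var borel (\<lambda>\<omega>. g (w k \<omega>)) borel (\<lambda>\<omega>. h (x k \<omega>))"
proof -
  let ?Y = "\<lambda>\<omega>. \<lambda>i\<in>{1..k}. x i \<omega>"
  \<comment> \<open>The tuple \<open>?Y\<close> omits \<open>x 0\<close>, which is constant.\<close>
  define H where "H t = (if k = 0 then h x0 else h (t k))" for t
  have "H \<in> borel_measurable (PiM {1..k} (\<lambda>_. borel))"
  proof (cases "k = 0")
    case False
    then show ?thesis
      unfolding H_def using h by simp
  next
    case True
    then have "H = (\<lambda>_. h x0)" by (simp add: H_def fun_eq_iff)
    then show ?thesis by simp
  qed
  moreover have "?Y \<in> measurable M (PiM {1..k} (\<lambda>_. borel))"
    using x by (intro measurable_restrict)
  moreover have "indep_rv M borel (w k) (PiM {1..k} (\<lambda>_. borel)) ?Y" "w k \<in> borel_measurable M"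
    using noise by (auto simp: noise_assumption_def)
  ultimately have "indep_var borel (\<lambda>\<omega>. g (w k \<omega>)) borel (\<lambda>\<omega>. H (?Y \<omega>))"
    using g indep_rv_compose by blast
  moreover have "H (?Y \<omega>) = h (x k \<omega>)" for \<omega>
    by (cases "k = 0") (simp_all add: H_def x0)
  ultimately show ?thesis by simp
qed

section \<open>Decoupling of gradient descent into eigenmodes and the limit of the expected
  suboptimality\<close>

theorem proposition3p2:
  fixes M :: "'s measure"
    and Q :: "real^'n^'n"
    and p x0 :: "real^'n"
    and r \<mu> L \<alpha> \<sigma> :: real
    and lam :: "nat \<Rightarrow> real"
    and f :: "real^'n \<Rightarrow> real"
    and w :: "nat \<Rightarrow> 's \<Rightarrow> real^'n"
  assumes "prob_space M"
    and "f = (\<lambda>x. 1/2 * (x \<bullet> (Q *v x)) - p \<bullet> x + r)"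
    and "pos_def_matrix Q"
    and "sorted_eigenvalues Q lam"
    and "0 < \<mu>" "\<mu> = lam 1" "lam (CARD('n)) = L"
    and "\<alpha> \<in> {0<..<2 / L}"
    and "noise_assumption M \<sigma> w (noisy_gd f \<alpha> x0 w)"
  shows "robustness M \<sigma> f (noisy_gd f \<alpha> x0 w)
           = ereal (\<Sum>i = 1..CARD('n). \<alpha>\<^sup>2 * lam i / (2 * (1 - (1 - \<alpha> * lam i)\<^sup>2))) \<and>
         (\<Sum>i = 1..CARD('n). \<alpha>\<^sup>2 * lam i / (2 * (1 - (1 - \<alpha> * lam i)\<^sup>2)))
           = \<alpha> * (\<Sum>i = 1..CARD('n). 1 / (2 * (2 - \<alpha> * lam i)))"
proof -
  interpret prob_space M by fact
  define d where "d = CARD('n)"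
  have d: "1 \<le> d" by (simp add: d_def Suc_le_eq)
  define x where "x = noisy_gd f \<alpha> x0 w"
  \<comment> \<open>The contribution of one eigenvalue, as a function of its value so that it can be
    summed over either indexing of the spectrum.\<close>
  define J where "J l = \<alpha>\<^sup>2 * l / (2 * (1 - (1 - \<alpha> * l)\<^sup>2))" for l
  have noise: "noise_assumption M \<sigma> w x" and "\<sigma> > 0"
    using assms(9) by (simp_all add: x_def noise_assumption_def)
  have sym: "transpose Q = Q" and pos: "\<And>v. v \<noteq> 0 \<Longrightarrow> v \<bullet> (Q *v v) > 0"
    using assms(3) by (auto simp: pos_def_matrix_def)
  have mono: "mono_on {1..d} lam" and char: "\<And>t. det (mat t - Q) = (\<Prod>i = 1..d. t - lam i)"
    using assms(4) by (auto simp: sorted_eigenvalues_def d_def)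
  have adj: "u \<bullet> (Q *v v) = (Q *v u) \<bullet> v" for u v
    using sym by (metis dot_lmul_matrix vector_transpose_matrix)
  have \<alpha>: "0 < \<alpha>" "\<alpha> < 2 / L" using assms(8) by auto
  \<comment> \<open>These bounds express stability: the factor \<open>1 - \<alpha> * lam i\<close>
    of each mode has modulus below 1.\<close>
  have lam: "0 < \<alpha> * lam i" "\<alpha> * lam i < 2" if "i \<in> {1..d}" for i
  proof -
    have "\<mu> \<le> lam i" "lam i \<le> L"
      using that d assms(6,7) by (auto simp: d_def intro!: mono_onD[OF mono[unfolded d_def]])
    with \<alpha> \<open>0 < \<mu>\<close> show "0 < \<alpha> * lam i" by simp
    have "\<alpha> * lam i \<le> \<alpha> * L"
      using \<alpha> \<open>lam i \<le> L\<close> by simp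
    also have "\<dots> < 2"
      using \<alpha> \<open>0 < \<mu>\<close> \<open>\<mu> \<le> lam i\<close> \<open>lam i \<le> L\<close> by (simp add: field_simps)
    finally show "\<alpha> * lam i < 2" .
  qed
  have closed_form: "J (lam i) = \<alpha> * (1 / (2 * (2 - \<alpha> * lam i)))" if "i \<in> {1..d}" for i
  proof -
    have "1 - (1 - \<alpha> * lam i)\<^sup>2 = (\<alpha> * lam i) * (2 - \<alpha> * lam i)"
      by (simp add: power2_eq_square algebra_simps)
    moreover have "lam i \<noteq> 0"
      using lam[OF that] by auto
    ultimately show ?thesis
      using lam[OF that] by (simp add: J_def power2_eq_square)
  qed

  obtain v e where v: "\<And>i j :: 'n. v i \<bullet> v j = (if i = j then 1 else 0)"
    and eig: "\<And>i. Q *v v i = e i *\<^sub>R v i"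
    using symmetric_matrix_eigenbasis[OF sym] by metis
  have spec: "(\<Sum>i = 1..d. {#lam i#}) = (\<Sum>i\<in>UNIV. {#e i#})"
    using char char_poly_of_eigenbasis[OF v eig] by (intro prod_linear_factors_unique) metis
  have sum_spec: "(\<Sum>i = 1..d. h (lam i)) = (\<Sum>i\<in>UNIV. h (e i))" for h :: "real \<Rightarrow> real"
    using spec sum_mset_image_sum_single[of "{1..d}" h lam]
      sum_mset_image_sum_single[of "UNIV :: 'n set" h e] by simp
  have "range e = lam ` {1..d}"
    using spec set_mset_sum_single[of "{1..d}" lam] set_mset_sum_single[of "UNIV :: 'n set" e] by simp
  have e: "\<bar>1 - \<alpha> * e i\<bar> < 1" for i
  proof -
    obtain j where "j \<in> {1..d}" "e i = lam j"
      using \<open>range e = lam ` {1..d}\<close> by blast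
    then show ?thesis
      using lam[of j] by (simp add: abs_if)
  qed

  \<comment> \<open>The minimiser of \<open>f\<close>: positive definiteness makes \<open>Q\<close>
    injective, hence surjective in finite dimension.\<close>
  obtain xs where xs: "Q *v xs = p"
  proof -
    have "inj (\<lambda>u. Q *v u)"
      using pos by (subst linear_injective_0) (force simp: matrix_vector_mul_linear)+
    then have "surj (\<lambda>u. Q *v u)"
      by (rule linear_inj_imp_surj[OF matrix_vector_mul_linear])
    then show ?thesis
      using that by (metis surjD)
  qed
  have f_quad: "f y - f xs = 1/2 * ((y - xs) \<bullet> (Q *v (y - xs)))" for y
  proof -
    have "xs \<bullet> (Q *v y) = p \<bullet> y" "y \<bullet> (Q *v xs) = p \<bullet> y" "xs \<bullet> (Q *v xs) = p \<bullet> xs"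
      using adj[of xs y] xs by (simp_all add: inner_commute)
    then show ?thesis
      by (simp add: assms(2) matrix_vector_mult_diff_distrib inner_diff field_simps)
  qed
  have f_diff: "f y - f xs = (\<Sum>i\<in>UNIV. e i / 2 * (v i \<bullet> (y - xs))\<^sup>2)" for y
  proof -
    let ?u = "y - xs"
    have "?u \<bullet> (Q *v ?u) = (Q *v ?u) \<bullet> (\<Sum>i\<in>UNIV. (v i \<bullet> ?u) *\<^sub>R v i)"
      unfolding orthonormal_expansion[OF v] by (rule inner_commute)
    also have "\<dots> = (\<Sum>i\<in>UNIV. (v i \<bullet> ?u) * (?u \<bullet> (Q *v v i)))"
      by (simp add: inner_sum_right adj)
    also have "\<dots> = (\<Sum>i\<in>UNIV. e i * (v i \<bullet> ?u)\<^sup>2)"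
      by (simp add: eig power2_eq_square inner_commute[of ?u] mult_ac)
    finally show ?thesis
      by (simp add: f_quad sum_distrib_left)
  qed
  \<comment> \<open>The real infimum is evaluated by showing that it is attained at
    \<open>xs\<close>.\<close>
  have f_min: "(INF y. f y) = f xs"
  proof (rule cInf_eq_minimum)
    have "f xs \<le> f y" for y
      using f_quad[of y] pos[of "y - xs"] by (cases "y = xs") auto
    then show "f xs \<le> t" if "t \<in> range f" for t
      using that by blast
  qed simp

  define z where "z i k \<omega> = v i \<bullet> (x k \<omega> - xs)" for i k \<omega>
  have xS: "x (Suc k) = (\<lambda>\<omega>. x k \<omega> - \<alpha> *\<^sub>R (Q *v x k \<omega> - p + w k \<omega>))" for k
    unfolding x_def noisy_gd.simps assms(2) gradient_quadratic[OF sym] ..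
  \<comment> \<open>Replacing \<open>p\<close> by \<open>Q *v xs\<close> makes the gradient linear
    in the error; symmetry then moves \<open>Q\<close> onto the eigenvector
    \<open>v i\<close>.\<close>
  have zS: "z i (Suc k) \<omega> = (1 - \<alpha> * e i) * z i k \<omega> - \<alpha> * (v i \<bullet> w k \<omega>)" for i k \<omega>
    using adj[of "v i"]
    by (simp add: z_def xS eig inner_diff inner_add algebra_simps flip: xs)
  have x_meas: "x k \<in> borel_measurable M" for k
  proof (induction k)
    case (Suc k)
    have "w k \<in> borel_measurable M"
      using noise by (simp add: noise_assumption_def)
    moreover have "(\<lambda>y. Q *v y) \<in> borel_measurable borel"
      by (intro borel_measurable_continuous_onI linear_continuous_on matrix_vector_mul_bounded_linear)
    then have "(\<lambda>\<omega>. Q *v x k \<omega>) \<in> borel_measurable M"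
      by (rule measurable_compose[OF Suc])
    ultimately show ?case
      using Suc by (simp add: xS)
  qed (simp add: x_def)
  have indep: "indep_var borel (\<lambda>\<omega>. v i \<bullet> w k \<omega>) borel (z i k)" for i k
    unfolding z_def
    by (rule noise_indep_functional[OF noise x_meas, of x0]) (simp_all add: x_def)
  have z0: "z i 0 \<omega> = v i \<bullet> (x0 - xs)" for i \<omega>
    by (simp add: z_def x_def)
  note n = noise_component[OF noise]
  have n2: "expectation (\<lambda>\<omega>. (v i \<bullet> w k \<omega>)\<^sup>2) = \<sigma>\<^sup>2" for i k
    by (simp add: n(4) v)
  have z_int: "integrable M (\<lambda>\<omega>. (z i k \<omega>)\<^sup>2)"
    and z_lim: "(\<lambda>k. expectation (\<lambda>\<omega>. (z i k \<omega>)\<^sup>2)) \<longlonglongrightarrow> \<alpha>\<^sup>2 * \<sigma>\<^sup>2 / (1 - (1 - \<alpha> * e i)\<^sup>2)" for i k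
    using ar1_second_moment[OF z0 zS e n(1,2,3) n2 indep] by blast+
  have "1 / \<sigma>\<^sup>2 * expectation (\<lambda>\<omega>. f (x k \<omega>) - (INF y. f y))
      = (\<Sum>i\<in>UNIV. e i / (2 * \<sigma>\<^sup>2) * expectation (\<lambda>\<omega>. (z i k \<omega>)\<^sup>2))" for k
    using z_int by (simp add: f_min f_diff sum_distrib_left mult_ac flip: z_def)
  moreover have "(\<lambda>k. \<Sum>i\<in>UNIV. e i / (2 * \<sigma>\<^sup>2) * expectation (\<lambda>\<omega>. (z i k \<omega>)\<^sup>2))
      \<longlonglongrightarrow> (\<Sum>i\<in>UNIV. e i / (2 * \<sigma>\<^sup>2) * (\<alpha>\<^sup>2 * \<sigma>\<^sup>2 / (1 - (1 - \<alpha> * e i)\<^sup>2)))"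
    by (intro tendsto_intros z_lim)
  moreover have "e i / (2 * \<sigma>\<^sup>2) * (\<alpha>\<^sup>2 * \<sigma>\<^sup>2 / (1 - (1 - \<alpha> * e i)\<^sup>2)) = J (e i)" for i
    using \<open>\<sigma> > 0\<close> by (simp add: J_def)
  \<comment> \<open>The limit arises as a sum over the eigenbasis; \<open>sum_spec\<close> rewrites
    it as a sum over the given \<open>lam\<close>.\<close>
  ultimately have "(\<lambda>k. ereal (1 / \<sigma>\<^sup>2 * expectation (\<lambda>\<omega>. f (x k \<omega>) - (INF y. f y))))
      \<longlonglongrightarrow> ereal (\<Sum>i = 1..d. J (lam i))"
    by (simp only: sum_spec lim_ereal)
  then have "robustness M \<sigma> f x = ereal (\<Sum>i = 1..d. J (lam i))"
    unfolding robustness_def by (rule lim_imp_Limsup[OF sequentially_bot])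
  moreover have "(\<Sum>i = 1..d. J (lam i)) = \<alpha> * (\<Sum>i = 1..d. 1 / (2 * (2 - \<alpha> * lam i)))"
    unfolding sum_distrib_left by (intro sum.cong closed_form refl)
  ultimately show ?thesis
    by (simp add: x_def J_def d_def)
qed

end
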